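(* Let $y_1,\dots,y_n\in[0,\infty)$ be a sample with $s_n^2:=\frac1n\sum_{i=1}^n(y_i-\bar y)^2>0$, where $\bar y=\frac1n\sum_{i=1}^n y_i$, and let $S_y:=\sum_{i=1}^n y_i^2$. Let $\ell_n(\mu,\sigma)=\sum_{i=1}^n\log f(y_i;\mu,\sigma)$ be the folded normal log-likelihood. For each $\sigma>0$, the function $\mu\mapsto\ell_n(\mu,\sigma)$ has a unique maximizer on $[0,\infty)$, denoted $\hat\mu(\sigma)$. Moreover: (i) If $\sigma^2\ge S_y/n$, then $\hat\mu(\sigma)=0$. (ii) If $\sigma^2<S_y/n$, then $\hat\mu(\sigma)\in(0,\infty)$ is the unique solution $\mu\in(0,\infty)$ of $$\sum_{i=1}^n y_i\tanh\!\Big(\frac{y_i\mu}{\sigma^2}\Big)=n\mu.$$ (iii) The global maximizers of $\mu\mapsto\ell_n(\mu,\sigma)$ over $\mu\in\mathbb{R}$ are $\pm\hat\mu(\sigma)$.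
   Context: The folded normal density with parameters $\mu\in\mathbb{R}$, $\sigma>0$ is $$f(y;\mu,\sigma)=\frac1\sigma\Big\{\varphi\Big(\frac{y-\mu}{\sigma}\Big)+\varphi\Big(\frac{y+\mu}{\sigma}\Big)\Big\}=\frac{2}{\sigma\sqrt{2\pi}}\exp\Big(-\frac{y^2+\mu^2}{2\sigma^2}\Big)\cosh\Big(\frac{y\mu}{\sigma^2}\Big),\quad y\ge0,$$ where $\varphi(z)=(2\pi)^{-1/2}e^{-z^2/2}$. *)

theory Defs
  imports "HOL-Probability.Distributions"
begin

text \<open>A sample \<open>y\<^sub>1, \<dots>, y\<^sub>n\<close> is a function \<open>y :: nat \<Rightarrow> real\<close> of which only the
  values on \<open>{1..n}\<close> are used.\<close>

text \<open>The density is meant for \<open>y \<ge> 0\<close> and \<open>\<sigma> > 0\<close>; it is not cut off to \<open>0\<close> for \<open>y < 0\<close>,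
  and is only evaluated at nonnegative sample points.\<close>

definition folded_normal_density :: "real \<Rightarrow> real \<Rightarrow> real \<Rightarrow> real" where
  "folded_normal_density \<mu> \<sigma> y =
     1 / \<sigma> * (std_normal_density ((y - \<mu>) / \<sigma>) + std_normal_density ((y + \<mu>) / \<sigma>))"

lemma folded_normal_density_cosh:
  assumes "\<sigma> > 0"
  shows "folded_normal_density \<mu> \<sigma> y =
    2 / (\<sigma> * sqrt (2 * pi)) * exp (- (y\<^sup>2 + \<mu>\<^sup>2) / (2 * \<sigma>\<^sup>2)) * cosh (y * \<mu> / \<sigma>\<^sup>2)"
proof -
  have m: "- ((y - \<mu>) / \<sigma>)\<^sup>2 / 2 = - (y\<^sup>2 + \<mu>\<^sup>2) / (2 * \<sigma>\<^sup>2) + y * \<mu> / \<sigma>\<^sup>2"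
    and p: "- ((y + \<mu>) / \<sigma>)\<^sup>2 / 2 = - (y\<^sup>2 + \<mu>\<^sup>2) / (2 * \<sigma>\<^sup>2) + - (y * \<mu> / \<sigma>\<^sup>2)"
    using assms by (simp_all add: field_simps power2_eq_square)
  show ?thesis
    unfolding folded_normal_density_def std_normal_density_def m p exp_add cosh_field_def
    using assms by (simp add: field_simps)
qed

definition folded_normal_loglik :: "nat \<Rightarrow> (nat \<Rightarrow> real) \<Rightarrow> real \<Rightarrow> real \<Rightarrow> real" where
  "folded_normal_loglik n y \<mu> \<sigma> = (\<Sum>i=1..n. ln (folded_normal_density \<mu> \<sigma> (y i)))"

definition sample_mean :: "nat \<Rightarrow> (nat \<Rightarrow> real) \<Rightarrow> real" where
  "sample_mean n y = (1 / real n) * (\<Sum>i=1..n. y i)"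

text \<open>Normalised by \<open>n\<close>, not \<open>n - 1\<close>. For \<open>n = 0\<close> the value is \<open>0\<close>, so positivity entails
  that the sample is nonempty.\<close>

definition sample_variance :: "nat \<Rightarrow> (nat \<Rightarrow> real) \<Rightarrow> real" where
  "sample_variance n y = (1 / real n) * (\<Sum>i=1..n. (y i - sample_mean n y)\<^sup>2)"

definition sample_sum_squares :: "nat \<Rightarrow> (nat \<Rightarrow> real) \<Rightarrow> real" where
  "sample_sum_squares n y = (\<Sum>i=1..n. (y i)\<^sup>2)"

text \<open>\<open>arg_max\<close> is a choice among the maximizers; it denotes \<open>the\<close> maximizer on \<open>[0,\<infinity>)\<close>
  only once existence and uniqueness are established.\<close>

definition folded_normal_mu_hat :: "nat \<Rightarrow> (nat \<Rightarrow> real) \<Rightarrow> real \<Rightarrow> real" where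
  "folded_normal_mu_hat n y \<sigma> =
     arg_max (\<lambda>\<mu>. folded_normal_loglik n y \<mu> \<sigma>) (\<lambda>\<mu>. \<mu> \<in> {0..})"

end

theory Submission
  imports Defs
begin

text \<open>Up to the factor \<open>\<sigma>\<^sup>2\<close>, the derivative of the log-likelihood in \<open>\<mu>\<close> is
  \<open>(\<Sum>i. y\<^sub>i * tanh (y\<^sub>i * \<mu> / \<sigma>\<^sup>2)) - n * \<mu>\<close>. Since \<open>tanh x / x\<close> decreases strictly from its limit
  \<open>1\<close> at \<open>0\<close>, dividing by \<open>\<mu>\<close> leaves a strictly decreasing function on \<open>(0,\<infinity>)\<close> that starts from
  \<open>S\<^sub>y / \<sigma>\<^sup>2 - n\<close>. So the derivative changes sign at most once, from positive to negative, and
  does so iff \<open>\<sigma>\<^sup>2 < S\<^sub>y / n\<close>. The statement on the whole line follows as the log-likelihood is even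
  in \<open>\<mu>\<close>.\<close>

section \<open>Inequalities for \<open>tanh\<close> on the positive half-line\<close>

lemma tanh_less_self:
  fixes x :: real
  assumes "0 < x"
  shows "tanh x < x"
proof -
  have "0 - tanh 0 < x - tanh x"
  proof (rule DERIV_pos_imp_increasing_open[OF assms])
    fix z :: real assume "0 < z" "z < x"
    have "((\<lambda>z. z - tanh z) has_real_derivative (1 - (1 - (tanh z)\<^sup>2))) (at z)"
      by (auto intro!: derivative_eq_intros)
    then show "\<exists>d. ((\<lambda>z. z - tanh z) has_real_derivative d) (at z) \<and> 0 < d"
      using \<open>0 < z\<close> by (intro exI[of _ "(tanh z)\<^sup>2"]) simp
  qed (auto intro!: continuous_intros)
  then show ?thesis by simp
qed

text \<open>The difference of the two sides vanishes at 0 and has derivative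
  \<open>2 * x * tanh x * (1 - (tanh x)\<^sup>2)\<close>, positive for \<open>x > 0\<close>. This
  fixes the sign of the numerator in the derivative of \<open>tanh x / x\<close>.\<close>

lemma tanh_gt_self_times_deriv:
  fixes x :: real
  assumes "0 < x"
  shows "x * (1 - (tanh x)\<^sup>2) < tanh x"
proof -
  have "tanh 0 - 0 * (1 - (tanh 0)\<^sup>2) < tanh x - x * (1 - (tanh x)\<^sup>2)"
  proof (rule DERIV_pos_imp_increasing_open[OF assms])
    fix z :: real assume z: "0 < z" "z < x"
    have "((\<lambda>z. tanh z - z * (1 - (tanh z)\<^sup>2)) has_real_derivative
        2 * z * tanh z * (1 - (tanh z)\<^sup>2)) (at z)"
      by (auto intro!: derivative_eq_intros simp: algebra_simps)
    moreover have "(tanh z)\<^sup>2 < 1"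
      using tanh_real_lt_1[of z] tanh_real_gt_neg1[of z] by (simp add: abs_square_less_1)
    ultimately show "\<exists>d. ((\<lambda>z. tanh z - z * (1 - (tanh z)\<^sup>2)) has_real_derivative d) (at z) \<and> 0 < d"
      using z by (intro exI[of _ "2 * z * tanh z * (1 - (tanh z)\<^sup>2)"]) simp
  qed (auto intro!: continuous_intros)
  then show ?thesis by simp
qed

lemma tanh_div_self_strict_antimono:
  fixes a b :: real
  assumes "0 < a" "a < b"
  shows "tanh b / b < tanh a / a"
proof (rule DERIV_neg_imp_decreasing[OF \<open>a < b\<close>])
  fix x :: real assume "a \<le> x" "x \<le> b"
  then have x: "0 < x" using assms by simp
  have "((\<lambda>x. tanh x / x) has_real_derivative (x * (1 - (tanh x)\<^sup>2) - tanh x) / x\<^sup>2) (at x)"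
    using x by (auto intro!: derivative_eq_intros simp: power2_eq_square algebra_simps)
  moreover have "(x * (1 - (tanh x)\<^sup>2) - tanh x) / x\<^sup>2 < 0"
    using tanh_gt_self_times_deriv[OF x] x by (simp add: divide_neg_pos)
  ultimately show "\<exists>d. ((\<lambda>x. tanh x / x) has_real_derivative d) (at x) \<and> d < 0" by blast
qed

text \<open>Both sides are \<open>c\<^sup>2 / s\<close> times a value of \<open>tanh u / u\<close>,
  taken at \<open>u = c * b / s\<close> and \<open>u = c * a / s\<close>. These are the summands of
  the score divided by \<mu>.\<close>

lemma tanh_weighted_scale_less:
  fixes a b c s :: real
  assumes "0 < a" "a < b" "0 < c" "0 < s"
  shows "c * tanh (c * b / s) / b < c * tanh (c * a / s) / a"
proof -
  have "tanh (c * b / s) / (c * b / s) < tanh (c * a / s) / (c * a / s)"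
    using assms by (intro tanh_div_self_strict_antimono) (auto simp: divide_simps)
  then have "c\<^sup>2 / s * (tanh (c * b / s) / (c * b / s)) < c\<^sup>2 / s * (tanh (c * a / s) / (c * a / s))"
    using assms by (intro mult_strict_left_mono) simp_all
  then show ?thesis using assms by (simp add: power2_eq_square field_simps)
qed

text \<open>\<open>f\<close> rises strictly from \<open>a\<close> up to \<open>m\<close> and falls
  strictly after it. No sign is asked for at \<open>a\<close> or \<open>m\<close>, since the score
  vanishes at 0 and at an interior maximizer; for \<open>m = a\<close> only the falling half
  remains.\<close>

lemma strict_max_of_deriv_sign:
  fixes f g :: "real \<Rightarrow> real"
  assumes deriv: "\<And>x. (f has_real_derivative g x) (at x)"
    and pos: "\<And>x. a < x \<Longrightarrow> x < m \<Longrightarrow> 0 < g x"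
    and neg: "\<And>x. m < x \<Longrightarrow> g x < 0"
    and x: "a \<le> x" "x \<noteq> m"
  shows "f x < f m"
proof -
  have cont: "continuous_on S f" for S
    by (rule continuous_at_imp_continuous_on) (blast intro: DERIV_isCont deriv)
  show ?thesis
  proof (cases "x < m")
    case True
    show ?thesis
      by (rule DERIV_pos_imp_increasing_open[OF True _ cont]) (use deriv pos x in fastforce)
  next
    case False
    with x have "m < x" by simp
    then show ?thesis
      by (rule DERIV_neg_imp_decreasing_open[OF _ _ cont]) (use deriv neg in fastforce)
  qed
qed

text \<open>A sample of zeros, in particular an empty one, has variance 0. A positive observation
  yields both \<open>n > 0\<close> and the strictness of the sum inequalities below.\<close>

lemma ex_pos_of_sample_variance_pos:
  assumes "sample_variance n y > 0" and nonneg: "\<forall>i\<in>{1..n}. y i \<ge> 0"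
  shows "\<exists>i\<in>{1..n}. y i > 0"
proof (rule ccontr)
  assume "\<not> ?thesis"
  with nonneg have "\<forall>i\<in>{1..n}. y i = 0" by force
  then have "sample_variance n y = 0" by (simp add: sample_variance_def sample_mean_def)
  with assms show False by simp
qed

section \<open>The log-likelihood and its score in \<mu>\<close>

definition folded_normal_score :: "nat \<Rightarrow> (nat \<Rightarrow> real) \<Rightarrow> real \<Rightarrow> real \<Rightarrow> real" where
  "folded_normal_score n y \<sigma> \<mu> = (\<Sum>i=1..n. y i * tanh (y i * \<mu> / \<sigma>\<^sup>2)) - real n * \<mu>"

text \<open>The logarithm splits the product form of the density because \<open>cosh\<close> is
  positive. In this form each summand is visibly even in \<mu> and easy to differentiate.\<close>

lemma folded_normal_loglik_eq:
  assumes "\<sigma> > 0"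
  shows "folded_normal_loglik n y \<mu> \<sigma> =
    (\<Sum>i=1..n. ln (2 / (\<sigma> * sqrt (2 * pi))) - ((y i)\<^sup>2 + \<mu>\<^sup>2) / (2 * \<sigma>\<^sup>2)
      + ln (cosh (y i * \<mu> / \<sigma>\<^sup>2)))"
proof -
  have "ln (a * exp x * cosh z) = ln a + x + ln (cosh z)" if "a > 0" for a x z :: real
    using that by (simp add: ln_mult)
  moreover have "2 / (\<sigma> * sqrt (2 * pi)) > 0" using assms by simp
  ultimately show ?thesis
    unfolding folded_normal_loglik_def folded_normal_density_cosh[OF assms]
    by (intro sum.cong) (simp_all only: minus_divide_left diff_conv_add_uminus)
qed

lemma has_real_derivative_folded_normal_loglik:
  assumes "\<sigma> > 0"
  shows "((\<lambda>\<mu>. folded_normal_loglik n y \<mu> \<sigma>) has_real_derivative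
    folded_normal_score n y \<sigma> \<mu> / \<sigma>\<^sup>2) (at \<mu>)"
proof -
  have summand: "((\<lambda>\<mu>. k - (c\<^sup>2 + \<mu>\<^sup>2) / (2 * s) + ln (cosh (c * \<mu> / s)))
      has_real_derivative (c * tanh (c * \<mu> / s) - \<mu>) / s) (at \<mu>)" if "s > 0" for c k s :: real
    using that by (auto intro!: derivative_eq_intros simp: tanh_def field_simps)
  have "((\<lambda>\<mu>. ln (2 / (\<sigma> * sqrt (2 * pi))) - ((y i)\<^sup>2 + \<mu>\<^sup>2) / (2 * \<sigma>\<^sup>2)
      + ln (cosh (y i * \<mu> / \<sigma>\<^sup>2))) has_real_derivative
    (y i * tanh (y i * \<mu> / \<sigma>\<^sup>2) - \<mu>) / \<sigma>\<^sup>2) (at \<mu>)" for i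
    using summand[of "\<sigma>\<^sup>2"] assms by simp
  then have "((\<lambda>\<mu>. folded_normal_loglik n y \<mu> \<sigma>) has_real_derivative
    (\<Sum>i=1..n. (y i * tanh (y i * \<mu> / \<sigma>\<^sup>2) - \<mu>) / \<sigma>\<^sup>2)) (at \<mu>)"
    unfolding folded_normal_loglik_eq[OF assms] by (intro DERIV_sum) blast
  also have "(\<Sum>i=1..n. (y i * tanh (y i * \<mu> / \<sigma>\<^sup>2) - \<mu>) / \<sigma>\<^sup>2) = folded_normal_score n y \<sigma> \<mu> / \<sigma>\<^sup>2"
    by (simp add: folded_normal_score_def sum_subtractf flip: sum_divide_distrib)
  finally show ?thesis .
qed

lemma folded_normal_loglik_minus:
  "\<sigma> > 0 \<Longrightarrow> folded_normal_loglik n y (- \<mu>) \<sigma> = folded_normal_loglik n y \<mu> \<sigma>"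
  by (simp add: folded_normal_loglik_eq)

text \<open>Serves the search for a zero: it gives continuity, and the slope at 0.\<close>

lemma has_real_derivative_folded_normal_score:
  assumes "\<sigma> > 0"
  shows "(folded_normal_score n y \<sigma> has_real_derivative
    (\<Sum>i=1..n. y i * ((1 - (tanh (y i * \<mu> / \<sigma>\<^sup>2))\<^sup>2) * (y i / \<sigma>\<^sup>2))) - real n) (at \<mu>)"
proof -
  have "((\<lambda>\<mu>. c * tanh (c * \<mu> / s)) has_real_derivative
      c * ((1 - (tanh (c * \<mu> / s))\<^sup>2) * (c / s))) (at \<mu>)" if "s > 0" for c s :: real
    using that by (auto intro!: derivative_eq_intros)
  then show ?thesis
    unfolding folded_normal_score_def using assms
    by (intro DERIV_diff DERIV_sum) (auto intro!: derivative_eq_intros)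
qed

section \<open>Sign and zeros of the score\<close>

lemma folded_normal_score_neg:
  assumes nonneg: "\<forall>i\<in>{1..n}. y i \<ge> 0" and pos: "\<exists>i\<in>{1..n}. y i > 0"
    and "\<sigma> > 0" "sample_sum_squares n y / real n \<le> \<sigma>\<^sup>2" "\<mu> > 0"
  shows "folded_normal_score n y \<sigma> \<mu> < 0"
proof -
  have n: "real n > 0" using pos by auto
  have less: "y i * tanh (y i * \<mu> / \<sigma>\<^sup>2) < (y i)\<^sup>2 * (\<mu> / \<sigma>\<^sup>2)" if "y i > 0" for i
  proof -
    have "y i * tanh (y i * \<mu> / \<sigma>\<^sup>2) < y i * (y i * \<mu> / \<sigma>\<^sup>2)"
      using that assms by (intro mult_strict_left_mono tanh_less_self) simp_all
    then show ?thesis by (simp add: power2_eq_square)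
  qed
  \<comment> \<open>Zero observations give equality of summands, so strictness comes from the
    positive one.\<close>
  have "(\<Sum>i=1..n. y i * tanh (y i * \<mu> / \<sigma>\<^sup>2)) < (\<Sum>i=1..n. (y i)\<^sup>2 * (\<mu> / \<sigma>\<^sup>2))"
  proof (rule sum_strict_mono_ex1)
    show "\<forall>i\<in>{1..n}. y i * tanh (y i * \<mu> / \<sigma>\<^sup>2) \<le> (y i)\<^sup>2 * (\<mu> / \<sigma>\<^sup>2)"
    proof
      fix i assume "i \<in> {1..n}"
      then consider "y i = 0" | "y i > 0" using nonneg by force
      then show "y i * tanh (y i * \<mu> / \<sigma>\<^sup>2) \<le> (y i)\<^sup>2 * (\<mu> / \<sigma>\<^sup>2)"
        by cases (use less[of i] in auto)
    qed
  qed (use pos less in auto)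
  also have "\<dots> = sample_sum_squares n y * (\<mu> / \<sigma>\<^sup>2)"
    unfolding sample_sum_squares_def by (rule sum_distrib_right[symmetric])
  also have "\<dots> \<le> (real n * \<sigma>\<^sup>2) * (\<mu> / \<sigma>\<^sup>2)"
    using assms n by (intro mult_right_mono) (simp_all add: field_simps)
  also have "\<dots> = real n * \<mu>" using assms by simp
  finally show ?thesis by (simp add: folded_normal_score_def)
qed

text \<open>Division by \<mu> turns the linear term into the constant \<open>n\<close>, and every
  summand with \<open>y i > 0\<close> decreases strictly. The score itself need not be monotone: it
  increases near 0 when its slope there is positive.\<close>

lemma folded_normal_score_div_strict_antimono:
  assumes nonneg: "\<forall>i\<in>{1..n}. y i \<ge> 0" and pos: "\<exists>i\<in>{1..n}. y i > 0"
    and "\<sigma> > 0" "0 < a" "a < b"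
  shows "folded_normal_score n y \<sigma> b / b < folded_normal_score n y \<sigma> a / a"
proof -
  have less: "y i * tanh (y i * b / \<sigma>\<^sup>2) / b < y i * tanh (y i * a / \<sigma>\<^sup>2) / a" if "y i > 0" for i
    using tanh_weighted_scale_less that assms by simp
  have "(\<Sum>i=1..n. y i * tanh (y i * b / \<sigma>\<^sup>2) / b) < (\<Sum>i=1..n. y i * tanh (y i * a / \<sigma>\<^sup>2) / a)"
  proof (rule sum_strict_mono_ex1)
    show "\<forall>i\<in>{1..n}. y i * tanh (y i * b / \<sigma>\<^sup>2) / b \<le> y i * tanh (y i * a / \<sigma>\<^sup>2) / a"
    proof
      fix i assume "i \<in> {1..n}"
      then consider "y i = 0" | "y i > 0" using nonneg by force
      then show "y i * tanh (y i * b / \<sigma>\<^sup>2) / b \<le> y i * tanh (y i * a / \<sigma>\<^sup>2) / a"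
        by cases (use less[of i] in auto)
    qed
  qed (use pos less in auto)
  then show ?thesis
    using assms by (simp add: folded_normal_score_def diff_divide_distrib flip: sum_divide_distrib)
qed

lemma folded_normal_score_root:
  assumes nonneg: "\<forall>i\<in>{1..n}. y i \<ge> 0" and pos: "\<exists>i\<in>{1..n}. y i > 0"
    and "\<sigma> > 0" "\<sigma>\<^sup>2 < sample_sum_squares n y / real n"
  obtains m where "m > 0" "folded_normal_score n y \<sigma> m = 0"
proof -
  have n: "real n > 0" using pos by auto
  \<comment> \<open>The score is 0 at 0, so a positive slope there makes it positive just to the
    right.\<close>
  have "(folded_normal_score n y \<sigma> has_real_derivative
      sample_sum_squares n y / \<sigma>\<^sup>2 - real n) (at 0)"
    using has_real_derivative_folded_normal_score[OF assms(3), of n y 0]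
    by (simp add: sample_sum_squares_def sum_divide_distrib power2_eq_square)
  moreover have "sample_sum_squares n y / \<sigma>\<^sup>2 - real n > 0"
    using assms n by (simp add: field_simps)
  ultimately obtain d where d: "d > 0"
    and "\<And>h. 0 < h \<Longrightarrow> h < d \<Longrightarrow> folded_normal_score n y \<sigma> 0 < folded_normal_score n y \<sigma> (0 + h)"
    using DERIV_pos_inc_right by blast
  from this(2)[of "d / 2"] d have left: "0 < folded_normal_score n y \<sigma> (d / 2)"
    by (simp add: folded_normal_score_def)
  \<comment> \<open>Since \<open>tanh\<close> stays below 1, the score is nonpositive at every point
    at or above the sample mean. Adding \<open>d / 2\<close> puts \<open>b\<close> to the right of
    the point where the score is positive.\<close>
  define b where "b = d / 2 + (\<Sum>i=1..n. y i) / real n"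
  have "(\<Sum>i=1..n. y i * tanh (y i * b / \<sigma>\<^sup>2)) \<le> (\<Sum>i=1..n. y i)"
    using nonneg by (intro sum_mono mult_left_le) (auto intro: less_imp_le tanh_real_lt_1)
  also have "\<dots> \<le> real n * b" using n d by (simp add: b_def field_simps)
  finally have right: "folded_normal_score n y \<sigma> b \<le> 0" by (simp add: folded_normal_score_def)
  have "d / 2 \<le> b" using nonneg by (auto simp: b_def intro!: divide_nonneg_nonneg sum_nonneg)
  moreover have "continuous_on {d / 2..b} (folded_normal_score n y \<sigma>)"
    by (rule continuous_at_imp_continuous_on)
      (blast intro: DERIV_isCont has_real_derivative_folded_normal_score[OF assms(3)])
  ultimately obtain m where "d / 2 \<le> m" "folded_normal_score n y \<sigma> m = 0"
    using IVT2'[of "folded_normal_score n y \<sigma>" b 0 "d / 2"] left right by auto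
  with d that[of m] show ?thesis by simp
qed

text \<open>Treats both regimes by a single point \<open>m\<close>: the boundary 0 if the score is
  negative throughout, otherwise its positive zero.\<close>

lemma folded_normal_score_sign_change:
  assumes nonneg: "\<forall>i\<in>{1..n}. y i \<ge> 0" and pos: "\<exists>i\<in>{1..n}. y i > 0" and "\<sigma> > 0"
  obtains m where "m \<ge> 0"
    and "m = 0 \<longleftrightarrow> sample_sum_squares n y / real n \<le> \<sigma>\<^sup>2"
    and "m > 0 \<longrightarrow> folded_normal_score n y \<sigma> m = 0"
    and "\<forall>\<mu>\<in>{0<..<m}. 0 < folded_normal_score n y \<sigma> \<mu>"
    and "\<forall>\<mu>>m. folded_normal_score n y \<sigma> \<mu> < 0"
proof (cases "sample_sum_squares n y / real n \<le> \<sigma>\<^sup>2")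
  case True
  show ?thesis
    by (rule that[of 0]) (use True folded_normal_score_neg[OF assms] in auto)
next
  case False
  then obtain m where m: "m > 0" "folded_normal_score n y \<sigma> m = 0"
    using folded_normal_score_root[OF assms] by auto
  \<comment> \<open>The quotient of score and \<mu> is 0 at \<open>m\<close>, so its strict decrease
    gives the signs on both sides.\<close>
  have "0 < folded_normal_score n y \<sigma> \<mu>" if "0 < \<mu>" "\<mu> < m" for \<mu>
    using folded_normal_score_div_strict_antimono[OF assms that] m that
    by (simp add: zero_less_divide_iff)
  moreover have "folded_normal_score n y \<sigma> \<mu> < 0" if "m < \<mu>" for \<mu>
    using folded_normal_score_div_strict_antimono[OF assms m(1) that] m that
    by (simp add: divide_less_0_iff)
  ultimately show ?thesis
    using that[of m] m False by auto
qed

theorem theorem3p6: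
  fixes n :: nat and y :: "nat \<Rightarrow> real" and \<sigma> :: real
  assumes "\<forall>i\<in>{1..n}. y i \<ge> 0"
    and "sample_variance n y > 0"
    and "\<sigma> > 0"
  shows "(\<exists>!\<mu>. is_arg_max (\<lambda>\<mu>. folded_normal_loglik n y \<mu> \<sigma>) (\<lambda>\<mu>. \<mu> \<in> {0..}) \<mu>)
    \<and> (\<sigma>\<^sup>2 \<ge> sample_sum_squares n y / real n \<longrightarrow> folded_normal_mu_hat n y \<sigma> = 0)
    \<and> (\<sigma>\<^sup>2 < sample_sum_squares n y / real n \<longrightarrow>
        folded_normal_mu_hat n y \<sigma> \<in> {0<..}
        \<and> (\<forall>\<mu>\<in>{0<..}. (\<Sum>i=1..n. y i * tanh (y i * \<mu> / \<sigma>\<^sup>2)) = real n * \<mu>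
              \<longleftrightarrow> \<mu> = folded_normal_mu_hat n y \<sigma>))
    \<and> {\<mu>. is_arg_max (\<lambda>\<mu>. folded_normal_loglik n y \<mu> \<sigma>) (\<lambda>\<mu>. \<mu> \<in> UNIV) \<mu>}
        = {folded_normal_mu_hat n y \<sigma>, - folded_normal_mu_hat n y \<sigma>}"
proof -
  let ?L = "\<lambda>\<mu>. folded_normal_loglik n y \<mu> \<sigma>"
  obtain m where m: "m \<ge> 0" "m = 0 \<longleftrightarrow> sample_sum_squares n y / real n \<le> \<sigma>\<^sup>2"
    and root: "m > 0 \<longrightarrow> folded_normal_score n y \<sigma> m = 0"
    and score_pos: "\<forall>\<mu>\<in>{0<..<m}. 0 < folded_normal_score n y \<sigma> \<mu>"
    and score_neg: "\<forall>\<mu>>m. folded_normal_score n y \<sigma> \<mu> < 0"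
    by (rule folded_normal_score_sign_change[OF assms(1)
          ex_pos_of_sample_variance_pos[OF assms(2,1)] assms(3)])
  have less: "?L \<mu> < ?L m" if "0 \<le> \<mu>" "\<mu> \<noteq> m" for \<mu>
    by (rule strict_max_of_deriv_sign[OF has_real_derivative_folded_normal_loglik[OF assms(3)]
          _ _ that])
      (use score_pos score_neg assms(3) in \<open>auto simp: divide_less_0_iff\<close>)
  have arg_max_iff: "is_arg_max ?L (\<lambda>\<mu>. \<mu> \<in> {0..}) \<mu> \<longleftrightarrow> \<mu> = m" for \<mu>
    using less m(1) unfolding is_arg_max_def by (metis atLeast_iff less_asym less_irrefl)
  \<comment> \<open>As \<open>m\<close> is the only maximizer, the choice made by
    \<open>arg_max\<close> must return it.\<close>
  then have hat: "folded_normal_mu_hat n y \<sigma> = m"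
    by (simp add: folded_normal_mu_hat_def arg_max_def)
  \<comment> \<open>Evenness replaces \<mu> by its absolute value, which carries the half-line
    result to all reals.\<close>
  have abs_less: "?L \<mu> < ?L m" if "\<bar>\<mu>\<bar> \<noteq> m" for \<mu>
    using less[of "\<bar>\<mu>\<bar>"] that folded_normal_loglik_minus[OF assms(3), of n y \<mu>]
    by (cases "\<mu> \<ge> 0") auto
  have abs_eq: "?L \<mu> = ?L m" if "\<bar>\<mu>\<bar> = m" for \<mu>
    using that folded_normal_loglik_minus[OF assms(3), of n y \<mu>] by (cases "\<mu> \<ge> 0") auto
  have "is_arg_max ?L (\<lambda>\<mu>. \<mu> \<in> UNIV) \<mu> \<longleftrightarrow> \<bar>\<mu>\<bar> = m" for \<mu>
    unfolding is_arg_max_def using abs_less abs_eq by (metis UNIV_I less_asym less_irrefl)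
  moreover have "\<bar>\<mu>\<bar> = m \<longleftrightarrow> \<mu> \<in> {m, - m}" for \<mu>
    using m(1) by (simp add: abs_if) linarith
  ultimately have "{\<mu>. is_arg_max ?L (\<lambda>\<mu>. \<mu> \<in> UNIV) \<mu>} = {m, - m}"
    by (intro set_eqI) (simp only: mem_Collect_eq)
  \<comment> \<open>The equation says that the score vanishes, which its strict signs on either side
    of \<open>m\<close> exclude for any other positive \<mu>.\<close>
  moreover have "(\<Sum>i=1..n. y i * tanh (y i * \<mu> / \<sigma>\<^sup>2)) = real n * \<mu> \<longleftrightarrow> \<mu> = m"
    if "\<mu> > 0" "m > 0" for \<mu>
    using root score_pos[rule_format, of \<mu>] score_neg[rule_format, of \<mu>] that
    by (cases \<mu> m rule: linorder_cases) (auto simp: folded_normal_score_def)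
  ultimately show ?thesis
    unfolding hat arg_max_iff using m by auto
qed

end
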